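(* Let $H=[h_1,h_2,\dots]$ be a transcendental semigroup. Then $BU(H)\neq\emptyset$.
   Context: A transcendental semigroup $H=[h_1,h_2,\dots]$ is the semigroup, under composition, generated by a (finite or countable) family $\{h_1,h_2,\dots\}$ of transcendental entire functions, i.e. the set of all finite compositions of the generators. The set $H$ is countable and infinite; let $(g_n)_{n\ge 1}$ be an enumeration of the elements of $H$ without repetition. The bungee set $BU(H)$ is the set of all $z\in\mathbb{C}$ for which there exist subsequences $(g_{m_k})$ and $(g_{n_k})$ of $(g_n)$, with $m_k,n_k\to\infty$ as $k\to\infty$, and a constant $R>0$ such that $|g_{m_k}(z)|<R$ for all $k$ and $|g_{n_k}(z)|\to\infty$ as $k\to\infty$. *)

theory Defs
  imports
    "HOL-Complex_Analysis.Complex_Analysis"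
    "HOL-Computational_Algebra.Polynomial"
begin

definition transcendental_entire :: "(complex \<Rightarrow> complex) \<Rightarrow> bool" where
  "transcendental_entire f \<longleftrightarrow> f holomorphic_on UNIV \<and> (\<nexists>p :: complex poly. f = poly p)"

text \<open>All compositions of one or more generators; the identity (the empty composition) is not
  included.\<close>

inductive_set semigroup_generated :: "('a \<Rightarrow> 'a) set \<Rightarrow> ('a \<Rightarrow> 'a) set"
  for F :: "('a \<Rightarrow> 'a) set" where
  generator: "h \<in> F \<Longrightarrow> h \<in> semigroup_generated F"
| composition: "\<lbrakk>f \<in> semigroup_generated F; g \<in> semigroup_generated F\<rbrakk>
    \<Longrightarrow> f \<circ> g \<in> semigroup_generated F"

text \<open>The bungee set \<open>BU(H)\<close>, as a function of an enumeration \<open>g\<close> of the semigroup \<open>H\<close>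
  (indexed from \<open>0\<close>). It does not depend on which enumeration without repetition is chosen.
  Subsequences are strictly increasing index sequences, so their indices tend to infinity.\<close>

definition bungee_set :: "(nat \<Rightarrow> complex \<Rightarrow> complex) \<Rightarrow> complex set" where
  "bungee_set g = {z. \<exists>(m :: nat \<Rightarrow> nat) (n :: nat \<Rightarrow> nat). strict_mono m \<and> strict_mono n \<and>
     (\<exists>R>0. \<forall>k. norm (g (m k) z) < R) \<and>
     filterlim (\<lambda>k. norm (g (n k) z)) at_top sequentially}"

end

theory Submission imports Defs begin

text \<open>Let \<open>f\<close> be any generator. Its iterates belong to the semigroup, so it suffices to find a
  point whose orbit under \<open>f\<close> alone is unbounded but returns infinitely often to a bounded region.
  Such an orbit is not eventually periodic, hence the iterates \<open>f ^^ n\<close> are different elements of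
  the semigroup, and the two kinds of visit give the two subsequences.

  The orbit is built from unit discs that are \<open>spreading\<close>: for any two separated unit discs, some
  iterate of the given one covers at least one of them. If there are spreading discs arbitrarily far
  from 0, one can steer alternately to one of two fixed spreading discs and to one of two very
  distant ones, and a nested sequence of compact sets yields the orbit
  (\<open>transcendental_oscillating_orbit\<close>).

  A disc that is not spreading has iterates that each omit one value from each of two fixed compact
  sets. By Schottky's theorem, one bounded orbit inside it then forces uniformly bounded orbits
  nearby (\<open>non_spreading_orbits_bounded\<close>). If all discs far from 0 were of this kind, boundedness
  would spread over a neighbourhood of infinity as soon as it holds at one point there, and the
  maximum principle would carry it to all discs about 0 (\<open>transcendental_spreading_far\<close>). Two facts
  rule this out.

  First, there are points with bounded orbit arbitrarily far from 0. By Picard's great theorem only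
  one value is omitted near infinity, so it is enough to have two points with bounded orbit; these
  come from a fixed point or a cycle of length two, which exists by Picard's little theorem
  (\<open>transcendental_two_bounded_orbits\<close>).

  Second, the iterates are unbounded on every large disc: as \<open>f\<close> grows faster than linearly,
  Schottky's theorem shows that the image of \<open>cball 0 r\<close> contains a sphere about 0 of at least twice
  the radius, and the argument can be repeated from there
  (\<open>transcendental_iterates_unbounded\<close>).\<close>

section \<open>Transcendental entire functions\<close>

lemma holomorphic_funpow:
  assumes "f holomorphic_on (UNIV :: complex set)"
  shows "(f ^^ n) holomorphic_on S"
proof (induction n)
  case (Suc n)
  have "f holomorphic_on (f ^^ n) ` S"
    using assms holomorphic_on_subset by blast
  then show ?case
    using holomorphic_on_compose[OF Suc] by (simp only: funpow.simps)
qed (simp add: id_def)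

lemma sum_powers_is_poly:
  fixes f :: "complex \<Rightarrow> complex"
  assumes "\<And>z. f z = (\<Sum>i\<le>n. a i * z ^ i)"
  shows "f = poly (\<Sum>i\<le>n. monom (a i) i)"
  by (rule ext) (simp add: assms poly_sum poly_monom)

text \<open>Transcendence makes infinity an essential singularity: a limit
  of \<open>f\<close> or of \<open>1/f\<close> at infinity would make \<open>f\<close> constant, respectively a polynomial. So Picard's
  great theorem applies to \<open>f (1/w)\<close> at \<open>w = 0\<close>.\<close>

lemma transcendental_Picard:
  assumes f: "transcendental_entire f" and "a \<noteq> b"
  shows "\<exists>z. norm z > R \<and> (f z = a \<or> f z = b)"
proof (rule ccontr)
  assume no: "\<not> ?thesis"
  have holf: "f holomorphic_on UNIV" and npoly: "\<nexists>p. f = poly p"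
    using f by (auto simp: transcendental_entire_def)
  define r where "r = 1 / (\<bar>R\<bar> + 1)"
  have "r > 0" by (simp add: r_def add_nonneg_pos)
  have big: "norm (inverse w) > R" if "w \<in> ball 0 r - {0}" for w :: complex
  proof -
    have "norm w < 1 / (\<bar>R\<bar> + 1)" "norm w > 0" using that by (auto simp: r_def)
    then have "\<bar>R\<bar> + 1 < inverse (norm w)"
      by (simp add: field_simps)
    then show ?thesis by (simp add: norm_inverse)
  qed
  have "(f \<circ> inverse) holomorphic_on ball 0 r - {0}"
  proof (rule holomorphic_on_compose)
    show "inverse holomorphic_on ball (0::complex) r - {0}"
      by (intro holomorphic_intros) auto
    show "f holomorphic_on inverse ` (ball 0 r - {0})"
      using holf holomorphic_on_subset by blast
  qed
  moreover have "(f \<circ> inverse) w \<noteq> a \<and> (f \<circ> inverse) w \<noteq> b" if "w \<in> ball 0 r - {0}" for w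
    using no big[OF that] by auto
  ultimately obtain l where
    "((f \<circ> inverse) \<longlongrightarrow> l) (at 0) \<or> ((inverse \<circ> (f \<circ> inverse)) \<longlongrightarrow> l) (at 0)"
    using great_Picard[of "ball 0 r" 0 a b "f \<circ> inverse"] \<open>a \<noteq> b\<close> \<open>r > 0\<close> by auto
  then consider "(f \<longlongrightarrow> l) at_infinity" | "((inverse \<circ> f) \<longlongrightarrow> l) at_infinity"
    by (auto simp: lim_at_infinity_0 o_assoc)
  then show False
  proof cases
    case 1
    then have "f = poly [:l:]"
      using Liouville_weak[OF holf] by auto
    then show False using npoly by blast
  next
    case 2
    obtain c n where "\<And>z. f z = (\<Sum>i\<le>n. c i * z ^ i)"
      using pole_at_infinity[OF holf 2] by blast
    then show False
      using npoly sum_powers_is_poly by blast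
  qed
qed

text \<open>Of three points where \<open>f\<close> takes the value 0 or 1, two share the value.\<close>

lemma transcendental_not_inj:
  assumes f: "transcendental_entire f"
  obtains z w where "z \<noteq> w" "f z = f w"
proof -
  have P: "\<exists>z. norm z > R \<and> (f z = 0 \<or> f z = 1)" for R
    using transcendental_Picard[OF f, of 0 1 R] by simp
  obtain z1 where "f z1 = 0 \<or> f z1 = 1" using P by blast
  moreover obtain z2 where "norm z2 > norm z1" "f z2 = 0 \<or> f z2 = 1" using P by blast
  moreover obtain z3 where "norm z3 > norm z2" "f z3 = 0 \<or> f z3 = 1" using P by blast
  ultimately have "z1 \<noteq> z2" "z2 \<noteq> z3" "z1 \<noteq> z3" "f z1 = f z2 \<or> f z2 = f z3 \<or> f z1 = f z3"
    by auto
  then show thesis using that by blast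
qed

text \<open>The difference quotient with its removable singularity filled in. Its zeros and its
  ones carry dynamical information when \<open>q\<close> is fixed, and its size measures superlinear growth.\<close>

definition slope :: "(complex \<Rightarrow> complex) \<Rightarrow> complex \<Rightarrow> complex \<Rightarrow> complex" where
  "slope f q z = (if z = q then deriv f q else (f z - f q) / (z - q))"

lemma transcendental_slope:
  assumes f: "transcendental_entire f"
  shows "transcendental_entire (slope f q)"
  unfolding transcendental_entire_def
proof
  have holf: "f holomorphic_on UNIV" and npoly: "\<nexists>p. f = poly p"
    using f by (auto simp: transcendental_entire_def)
  show "slope f q holomorphic_on UNIV"
    unfolding slope_def using pole_lemma[OF holf, of q] by simp
  show "\<nexists>p. slope f q = poly p"
  proof
    assume "\<exists>p. slope f q = poly p"
    then obtain p where p: "slope f q = poly p" ..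
    have "f z = poly ([:f q:] + [:- q, 1:] * p) z" for z
    proof -
      have "poly p z = slope f q z" by (simp add: p)
      then have "f z = f q + (z - q) * poly p z" by (auto simp: slope_def)
      then show ?thesis by (simp add: algebra_simps)
    qed
    then show False using npoly by blast
  qed
qed

section \<open>Bounded orbits\<close>

definition bounded_orbit :: "(complex \<Rightarrow> complex) \<Rightarrow> complex \<Rightarrow> bool" where
  "bounded_orbit f z \<longleftrightarrow> bounded (range (\<lambda>n. (f ^^ n) z))"

lemma bounded_orbit_iff: "bounded_orbit f z \<longleftrightarrow> (\<exists>B. \<forall>n. norm ((f ^^ n) z) \<le> B)"
  by (auto simp: bounded_orbit_def bounded_iff)

lemma bounded_orbit_step: "bounded_orbit f z \<longleftrightarrow> bounded_orbit f (f z)"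
proof
  assume "bounded_orbit f z"
  then obtain B where "\<And>n. norm ((f ^^ n) z) \<le> B" by (auto simp: bounded_orbit_iff)
  then have "norm ((f ^^ n) (f z)) \<le> B" for n
    by (metis funpow_swap1 funpow.simps(2) o_apply)
  then show "bounded_orbit f (f z)" by (auto simp: bounded_orbit_iff)
next
  assume "bounded_orbit f (f z)"
  then obtain B where B: "\<And>n. norm ((f ^^ n) (f z)) \<le> B" by (auto simp: bounded_orbit_iff)
  have "norm ((f ^^ n) z) \<le> max (norm z) B" for n
  proof (cases n)
    case (Suc m)
    then show ?thesis using B[of m] by (simp add: funpow_swap1)
  qed simp
  then show "bounded_orbit f z" by (auto simp only: bounded_orbit_iff)
qed

text \<open>A return of the orbit to an earlier point makes it finite: every later iterate agrees with
  one of the first \<open>b\<close>.\<close>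

lemma bounded_orbit_recurrence:
  assumes "(f ^^ a) z = (f ^^ b) z" "a < b"
  shows "bounded_orbit f z"
proof -
  have "(f ^^ n) z \<in> (\<lambda>m. (f ^^ m) z) ` {..<b}" for n
  proof (induction n rule: less_induct)
    case (less n)
    show ?case
    proof (cases "n < b")
      case False
      have "(f ^^ n) z = (f ^^ (n - b)) ((f ^^ b) z)"
        using False by (metis funpow_add le_add_diff_inverse2 not_less o_apply)
      also have "\<dots> = (f ^^ (n - b + a)) z"
        by (simp add: funpow_add assms(1))
      finally show ?thesis
        using less.IH[of "n - b + a"] False assms(2) by simp
    qed auto
  qed
  then show ?thesis
    unfolding bounded_orbit_def
    by (metis (no_types, lifting) bounded_subset finite_imageI finite_imp_bounded finite_lessThan
        image_subsetI)
qed

lemma bounded_orbit_fixpoint: "f q = q \<Longrightarrow> bounded_orbit f q"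
  by (rule bounded_orbit_recurrence[of 0 f q 1]) auto

lemma bounded_orbit_period_2: "f (f q) = q \<Longrightarrow> bounded_orbit f q"
  by (rule bounded_orbit_recurrence[of 0 f q 2]) (auto simp: numeral_2_eq_2)

text \<open>If \<open>f\<close> has no fixed point and no point of period two, the quotient
  \<open>(f (f z) - z) / (f z - z)\<close> is entire and omits 0 and 1, so it is a constant \<open>c\<close> different
  from 1. Then \<open>f (f z) = c f z + (1 - c) z\<close> recovers \<open>z\<close> from \<open>f z\<close>, against
  \<open>transcendental_not_inj\<close>.\<close>

lemma transcendental_period_2:
  assumes f: "transcendental_entire f"
  shows "\<exists>q. f (f q) = q"
proof (rule ccontr)
  assume "\<nexists>q. f (f q) = q"
  then have no2: "f (f z) \<noteq> z" and no1: "f z \<noteq> z" for z by metis+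
  have holf: "f holomorphic_on UNIV"
    using f by (simp add: transcendental_entire_def)
  define c where "c = (\<lambda>z. (f (f z) - z) / (f z - z))"
  have "(f \<circ> f) holomorphic_on UNIV"
    by (rule holomorphic_on_compose_gen[OF holf holf]) auto
  then have "c holomorphic_on UNIV"
    unfolding c_def using holf no1
    by (intro holomorphic_intros) (auto simp: o_def)
  moreover have ne0: "c z \<noteq> 0" for z using no1 no2 by (simp add: c_def)
  moreover have ne1: "c z \<noteq> 1" for z using no1 by (simp add: c_def)
  ultimately obtain k where k: "c = (\<lambda>x. k)"
    using little_Picard[of c 0 1] by (metis disjoint_insert(2) inf_bot_right rangeE zero_neq_one)
  have eq: "f (f z) - z = k * (f z - z)" for z
    using fun_cong[OF k, of z] no1[of z] by (simp add: c_def field_simps)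
  obtain z w where "z \<noteq> w" "f z = f w"
    using transcendental_not_inj[OF f] .
  have ff: "f (f v) = k * (f v - v) + v" for v
    using eq[of v] by (metis diff_add_cancel)
  have "k * (f z - z) + z = k * (f z - w) + w"
    using ff[of z] ff[of w] \<open>f z = f w\<close> by simp
  then have "(1 - k) * (z - w) = 0"
    by algebra
  then show False using ne1[of 0] \<open>z \<noteq> w\<close> k by simp
qed

text \<open>Given a fixed point \<open>q\<close>, the slope of \<open>f\<close> at \<open>q\<close> takes the value 0 or 1 at some other point
  \<open>z\<close>; these values mean \<open>f z = q\<close> and \<open>f z = z\<close>.\<close>

lemma transcendental_two_bounded_orbits:
  assumes f: "transcendental_entire f"
  obtains q q' where "q \<noteq> q'" "bounded_orbit f q" "bounded_orbit f q'"
proof -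
  obtain q where q: "f (f q) = q" using transcendental_period_2[OF f] by blast
  have bq: "bounded_orbit f q" using q by (rule bounded_orbit_period_2)
  show thesis
  proof (cases "f q = q")
    case False
    then show thesis using bq bounded_orbit_step[of f q] by (intro that[of q "f q"]) auto
  next
    case True
    obtain z where z: "norm z > norm q" "slope f q z = 0 \<or> slope f q z = 1"
      using transcendental_Picard[OF transcendental_slope[OF f], of 0 1 "norm q" q] by auto
    then have "z \<noteq> q" by auto
    then have "f z = q \<or> f z = z"
      using z(2) True by (auto simp: slope_def)
    then have "bounded_orbit f z"
    proof
      assume "f z = q"
      then show ?thesis using bq bounded_orbit_step[of f z] by (simp only:)
    qed (rule bounded_orbit_fixpoint)
    then show thesis using \<open>z \<noteq> q\<close> bq by (intro that[of q z]) auto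
  qed
qed

text \<open>At most one value is omitted near infinity, so one of two points with bounded orbit has a
  preimage there.\<close>

lemma transcendental_bounded_orbit_far:
  assumes f: "transcendental_entire f"
  shows "\<exists>z. norm z > R \<and> bounded_orbit f z"
proof -
  obtain q q' where q: "q \<noteq> q'" "bounded_orbit f q" "bounded_orbit f q'"
    using transcendental_two_bounded_orbits[OF f] .
  obtain z where "norm z > R" "f z = q \<or> f z = q'"
    using transcendental_Picard[OF f q(1)] by blast
  then show ?thesis using q bounded_orbit_step[of f z] by metis
qed

section \<open>Growth of iterates on large discs\<close>

text \<open>The constant in Schottky's theorem for the half radius \<open>t = 1/2\<close>.\<close>

definition schottky_bound :: "real \<Rightarrow> real" where
  "schottky_bound \<rho> = exp (pi * exp (pi * (14 + 2 * \<rho>)))"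

lemma schottky_bound_pos: "schottky_bound \<rho> > 0"
  by (simp add: schottky_bound_def)

text \<open>Schottky's theorem for arbitrary discs and arbitrary omitted values. The normalisation by
  \<open>b - a\<close> makes the bound depend only on \<open>\<rho>\<close>, so \<open>a\<close> and \<open>b\<close> may later change from one iterate to
  the next.\<close>

lemma Schottky_half_cball:
  assumes holg: "g holomorphic_on cball x s" and "s > 0"
    and omit: "\<And>z. z \<in> cball x s \<Longrightarrow> g z \<noteq> a \<and> g z \<noteq> b" and "a \<noteq> b"
    and centre: "norm (g x - a) \<le> \<rho> * norm (b - a)" and y: "y \<in> cball x (s / 2)"
  shows "norm (g y - a) \<le> schottky_bound \<rho> * norm (b - a)"
proof -
  define h where "h = (\<lambda>w. (g (x + of_real s * w) - a) / (b - a))"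
  have img: "x + of_real s * w \<in> cball x s" if "w \<in> cball 0 1" for w
  proof -
    have "s * norm w \<le> s * 1"
      using that \<open>s > 0\<close> by (intro mult_left_mono) auto
    then show ?thesis using \<open>s > 0\<close> by (simp add: dist_norm norm_mult)
  qed
  have "(g \<circ> (\<lambda>w. x + of_real s * w)) holomorphic_on cball 0 1"
    by (rule holomorphic_on_compose_gen[OF _ holg]) (use img in \<open>auto intro!: holomorphic_intros\<close>)
  then have "h holomorphic_on cball 0 1"
    unfolding h_def using \<open>a \<noteq> b\<close> by (intro holomorphic_intros) (auto simp: o_def)
  moreover have "norm (h 0) \<le> \<rho>"
    using centre \<open>a \<noteq> b\<close> by (simp add: h_def norm_divide divide_le_eq)
  moreover have "\<not> (h w = 0 \<or> h w = 1)" if "w \<in> cball 0 1" for w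
    using omit[OF img[OF that]] \<open>a \<noteq> b\<close> by (simp add: h_def)
  moreover define w where "w = (y - x) / of_real s"
  have "norm w \<le> 1 / 2"
    using y \<open>s > 0\<close> by (simp add: w_def norm_divide dist_norm norm_minus_commute field_simps)
  ultimately have "norm (h w) \<le> exp (pi * exp (pi * (2 + 2 * \<rho> + 12 * (1/2) / (1 - 1/2))))"
    by (intro Schottky) auto
  then have "norm (h w) \<le> schottky_bound \<rho>"
    by (simp add: schottky_bound_def algebra_simps)
  moreover have "h w = (g y - a) / (b - a)"
    using \<open>s > 0\<close> by (simp add: h_def w_def)
  ultimately show ?thesis
    using \<open>a \<noteq> b\<close> by (simp add: norm_divide divide_le_eq)
qed

lemma maximum_modulus_cball:
  assumes "f holomorphic_on UNIV" "r > 0" "z \<in> cball 0 r" "norm (f z) \<ge> B"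
  obtains w where "w \<in> sphere 0 r" "norm (f w) \<ge> B"
proof -
  have "compact (sphere (0::complex) r)" "sphere (0::complex) r \<noteq> {}" using \<open>r > 0\<close> by auto
  moreover have conf: "continuous_on S f" for S
    using assms(1) continuous_on_subset holomorphic_on_imp_continuous_on by blast
  then have "continuous_on (sphere 0 r) (\<lambda>w. norm (f w))"
    by (intro continuous_intros)
  ultimately obtain w where w: "w \<in> sphere 0 r" "\<forall>v\<in>sphere 0 r. norm (f v) \<le> norm (f w)"
    using continuous_attains_sup by blast
  have "norm (f z) \<le> norm (f w)"
  proof (rule maximum_modulus_frontier[of f "cball 0 r"])
    show "f holomorphic_on interior (cball 0 r)"
      using assms(1) holomorphic_on_subset by blast
  qed (use conf assms w \<open>r > 0\<close> in auto)
  then show thesis using that w assms(4) by force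
qed

text \<open>The slope of \<open>f\<close> at 0 is entire and, by Liouville, unbounded; its maximum modulus on
  \<open>cball 0 r\<close> increases with \<open>r\<close> and is attained on the sphere.\<close>

lemma transcendental_superlinear:
  assumes f: "transcendental_entire f"
  obtains r0 where "r0 > 0" "\<And>r. r \<ge> r0 \<Longrightarrow> \<exists>z\<in>sphere 0 r. norm (f z - f 0) \<ge> C * r"
proof -
  let ?u = "slope f 0"
  have tu: "transcendental_entire ?u" by (rule transcendental_slope[OF f])
  then have holu: "?u holomorphic_on UNIV" by (simp add: transcendental_entire_def)
  have "\<not> bounded (range ?u)"
  proof
    assume "bounded (range ?u)"
    then obtain k where "\<And>z. ?u z = k"
      using Liouville_theorem[OF holu] by (auto simp: constant_on_def)
    then have "?u = poly [:k:]" by auto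
    then show False using tu by (auto simp: transcendental_entire_def)
  qed
  then obtain z0 where z0: "norm (?u z0) > C"
    by (auto simp: bounded_iff not_le)
  show thesis
  proof
    show "norm z0 + 1 > 0" by (simp add: add_nonneg_pos)
    fix r assume r: "r \<ge> norm z0 + 1"
    then have "r > 0" using norm_ge_zero[of z0] by linarith
    then obtain w where w: "w \<in> sphere 0 r" "norm (?u w) \<ge> C"
      using maximum_modulus_cball[OF holu, of r z0 C] r z0 by auto
    then have "norm (f w - f 0) = norm (?u w) * r"
      using \<open>r > 0\<close> by (auto simp: slope_def norm_divide)
    then show "\<exists>z\<in>sphere 0 r. norm (f z - f 0) \<ge> C * r"
      using w \<open>r > 0\<close> by (auto intro!: bexI[of _ w])
  qed
qed

text \<open>A weak form of Bohr's covering theorem. If the image of \<open>cball 0 r\<close> missed a point of each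
  sphere, Schottky's theorem would bound \<open>f\<close> on \<open>cball 0 (r/2)\<close> by a fixed multiple of \<open>r\<close>.\<close>

lemma transcendental_image_contains_sphere:
  assumes f: "transcendental_entire f"
  obtains r0 where "r0 > 0"
    "\<And>r. r \<ge> r0 \<Longrightarrow> sphere 0 (2 * r) \<subseteq> f ` cball 0 r \<or> sphere 0 (4 * r) \<subseteq> f ` cball 0 r"
proof -
  have holf: "f holomorphic_on UNIV" using f by (simp add: transcendental_entire_def)
  define K where "K = schottky_bound 2"
  have "K > 0" by (simp add: K_def schottky_bound_pos)
  \<comment> \<open>At radius \<open>r/2\<close> this growth rate exceeds by \<open>r\<close> the bound \<open>6 K r + 3 r\<close> obtained below.\<close>
  define C where "C = 12 * K + 8"
  obtain r1 where r1: "r1 > 0" "\<And>r. r \<ge> r1 \<Longrightarrow> \<exists>z\<in>sphere 0 r. norm (f z - f 0) \<ge> C * r"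
    using transcendental_superlinear[OF f, of C] by blast
  show thesis
  proof
    show "2 * r1 + norm (f 0) > 0" using r1(1) by (simp add: add_pos_nonneg)
    fix r assume r: "r \<ge> 2 * r1 + norm (f 0)"
    then have "r > 0" "r / 2 \<ge> r1" "norm (f 0) \<le> r"
      using r1(1) norm_ge_zero[of "f 0"] by linarith+
    show "sphere 0 (2 * r) \<subseteq> f ` cball 0 r \<or> sphere 0 (4 * r) \<subseteq> f ` cball 0 r"
    proof (rule ccontr)
      assume "\<not> ?thesis"
      then obtain a b where a: "norm a = 2 * r" "a \<notin> f ` cball 0 r"
        and b: "norm b = 4 * r" "b \<notin> f ` cball 0 r"
        by (auto simp only: subset_iff mem_sphere_0)
      have ba: "norm (b - a) \<ge> 2 * r" "norm (b - a) \<le> 6 * r"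
        using a b norm_triangle_ineq2[of b a] norm_triangle_ineq4[of b a] by linarith+
      obtain z where z: "z \<in> sphere 0 (r / 2)" "norm (f z - f 0) \<ge> C * (r / 2)"
        using r1(2)[OF \<open>r / 2 \<ge> r1\<close>] by blast
      have "norm (f z - a) \<le> K * norm (b - a)"
        unfolding K_def
      proof (rule Schottky_half_cball[of f 0 r])
        show "norm (f 0 - a) \<le> 2 * norm (b - a)"
          using a ba norm_triangle_ineq4[of "f 0" a] \<open>norm (f 0) \<le> r\<close> \<open>r > 0\<close> by linarith
        show "f holomorphic_on cball 0 r" using holf holomorphic_on_subset by blast
        show "f w \<noteq> a \<and> f w \<noteq> b" if "w \<in> cball 0 r" for w
          using that a(2) b(2) by auto
        show "a \<noteq> b" using a b \<open>r > 0\<close> by auto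
        show "z \<in> cball 0 (r / 2)" using z(1) by auto
      qed (use \<open>r > 0\<close> in auto)
      also have "\<dots> \<le> K * (6 * r)"
        using ba(2) \<open>K > 0\<close> by (intro mult_left_mono) auto
      finally have "norm (f z - a) \<le> 6 * K * r" by simp
      moreover have "norm (f z - f 0) \<le> norm (f z - a) + norm (a - f 0)"
        using norm_triangle_ineq[of "f z - a" "a - f 0"] by simp
      moreover have "norm (a - f 0) \<le> 3 * r"
        using norm_triangle_ineq4[of a "f 0"] a(1) \<open>norm (f 0) \<le> r\<close> by linarith
      moreover have "C * (r / 2) = 6 * K * r + 4 * r"
        by (simp add: C_def algebra_simps)
      ultimately show False using z(2) \<open>r > 0\<close> by linarith
    qed
  qed
qed

text \<open>The image of \<open>cball 0 r\<close> surrounds 0 by a sphere of radius \<open>2r\<close> or \<open>4r\<close>, on which, by the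
  maximum principle, the next iterates are as large as on the whole disc of that radius.\<close>

lemma transcendental_iterates_unbounded:
  assumes f: "transcendental_entire f"
  obtains r0 where "r0 > 0" "\<And>r n. r \<ge> r0 \<Longrightarrow> \<exists>z\<in>cball 0 r. norm ((f ^^ n) z) \<ge> 2 ^ n * r"
proof -
  have holf: "f holomorphic_on UNIV" using f by (simp add: transcendental_entire_def)
  obtain r0 where r0: "r0 > 0"
    "\<And>r. r \<ge> r0 \<Longrightarrow> sphere 0 (2 * r) \<subseteq> f ` cball 0 r \<or> sphere 0 (4 * r) \<subseteq> f ` cball 0 r"
    using transcendental_image_contains_sphere[OF f] by blast
  have "\<exists>z\<in>cball 0 r. norm ((f ^^ n) z) \<ge> 2 ^ n * r" if "r \<ge> r0" for r n
    using that
  proof (induction n arbitrary: r)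
    case 0
    then show ?case
      using r0(1) by (intro bexI[of _ "of_real r"]) auto
  next
    case (Suc n)
    obtain s where s: "s \<ge> 2 * r" "sphere 0 s \<subseteq> f ` cball 0 r"
    proof -
      have "2 * r \<le> 4 * r" using Suc.prems r0(1) by linarith
      then show ?thesis
        using r0(2)[OF Suc.prems] that[of "2 * r"] that[of "4 * r"] by blast
    qed
    then have "s \<ge> r0" "s > 0" using Suc.prems r0(1) by linarith+
    obtain z where "z \<in> cball 0 s" "norm ((f ^^ n) z) \<ge> 2 ^ n * s"
      using Suc.IH[OF \<open>s \<ge> r0\<close>] by blast
    then obtain w where w: "w \<in> sphere 0 s" "norm ((f ^^ n) w) \<ge> 2 ^ n * s"
      using maximum_modulus_cball[OF holomorphic_funpow[OF holf] \<open>s > 0\<close>] by metis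
    then obtain v where v: "v \<in> cball 0 r" "w = f v" using s(2) by auto
    have "2 ^ Suc n * r \<le> 2 ^ n * s"
      using s(1) by simp
    also have "\<dots> \<le> norm ((f ^^ Suc n) v)"
      using w v by (simp add: funpow_swap1)
    finally show ?case using v(1) by blast
  qed
  then show thesis using that r0(1) by blast
qed

section \<open>Discs whose iterates spread\<close>

text \<open>This takes the place of the Julia set: two targets are offered because Schottky's theorem
  needs two omitted values, and all discs have radius 1 so that a covered disc can itself be the
  starting disc of the next step. Distance greater than 2 makes the targets disjoint, which keeps
  the omitted values apart.\<close>

definition spreading :: "(complex \<Rightarrow> complex) \<Rightarrow> complex \<Rightarrow> bool" where
  "spreading f p \<longleftrightarrow> (\<forall>a b. dist a b > 2 \<longrightarrow>
     (\<exists>n\<ge>1. cball a 1 \<subseteq> (f ^^ n) ` cball p 1 \<or> cball b 1 \<subseteq> (f ^^ n) ` cball p 1))"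

text \<open>The omitted values depend on the iterate, but they lie in two fixed disjoint discs, so their
  sizes are bounded and their distance is bounded below. Schottky's theorem then bounds all
  iterates by one constant, starting from the bounded orbit of \<open>x\<close>.\<close>

lemma non_spreading_orbits_bounded:
  assumes holf: "f holomorphic_on UNIV" and "\<not> spreading f p"
    and x: "x \<in> ball p (1/8)" "bounded_orbit f x"
  shows "\<exists>C. \<forall>y\<in>ball p (1/8). \<forall>n. norm ((f ^^ n) y) \<le> C"
proof -
  obtain a b where ab: "dist a b > 2"
    and omit: "\<And>n. n \<ge> 1 \<Longrightarrow> \<not> cball a 1 \<subseteq> (f ^^ n) ` cball p 1 \<and> \<not> cball b 1 \<subseteq> (f ^^ n) ` cball p 1"
    using \<open>\<not> spreading f p\<close> unfolding spreading_def by blast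
  obtain B where B: "\<And>n. norm ((f ^^ n) x) \<le> B"
    using x(2) by (auto simp: bounded_orbit_iff)
  then have "B \<ge> 0" using norm_ge_zero order_trans by blast
  define \<delta> where "\<delta> = dist a b - 2"
  define \<rho> where "\<rho> = (B + norm a + 1) / \<delta>"
  define K where "K = schottky_bound \<rho>"
  define C where "C = max (norm p + 1) (norm a + 1 + K * (dist a b + 2))"
  have "\<delta> > 0" using ab by (simp add: \<delta>_def)
  have "\<rho> \<ge> 0" using \<open>B \<ge> 0\<close> \<open>\<delta> > 0\<close> by (simp add: \<rho>_def)
  have "K > 0" by (simp add: K_def schottky_bound_pos)
  have "norm ((f ^^ n) y) \<le> C" if y: "y \<in> ball p (1/8)" for y n
  proof (cases "n = 0")
    case True
    have "norm y \<le> norm p + 1"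
      using y norm_triangle_ineq2[of y p] by (simp add: dist_norm norm_minus_commute)
    then show ?thesis using True by (simp add: C_def)
  next
    case False
    then have "n \<ge> 1" by simp
    obtain c d where c: "c \<in> cball a 1" "c \<notin> (f ^^ n) ` cball p 1"
      and d: "d \<in> cball b 1" "d \<notin> (f ^^ n) ` cball p 1"
      using omit[OF \<open>n \<ge> 1\<close>] unfolding subset_iff by blast
    have dc: "norm (d - c) \<ge> \<delta>" "norm (d - c) \<le> dist a b + 2"
    proof -
      have "dist a b \<le> dist a c + dist c d + dist d b" "dist c d \<le> dist c a + dist a b + dist b d"
        using dist_triangle[of a b c] dist_triangle[of c b d] dist_triangle[of c d a]
          dist_triangle[of a d b] by linarith+
      moreover have "dist a c \<le> 1" "dist b d \<le> 1" using c d by auto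
      ultimately show "norm (d - c) \<ge> \<delta>" "norm (d - c) \<le> dist a b + 2"
        by (simp_all add: \<delta>_def dist_norm norm_minus_commute)
    qed
    have nc: "norm c \<le> norm a + 1"
      using c(1) norm_triangle_ineq2[of c a] by (simp add: dist_norm norm_minus_commute)
    \<comment> \<open>For \<open>x\<close> within \<open>1/8\<close> of \<open>p\<close>, the disc of radius \<open>3/4\<close> about \<open>x\<close> lies in \<open>cball p 1\<close>, and
      half that radius still reaches all of \<open>ball p (1/8)\<close>.\<close>
    have sub: "w \<in> cball p 1" if "w \<in> cball x (3/4)" for w
    proof -
      have "dist p w \<le> dist p x + dist x w" by (rule dist_triangle)
      then show ?thesis using that x(1) by simp
    qed
    have "norm ((f ^^ n) y - c) \<le> K * norm (d - c)"
      unfolding K_def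
    proof (rule Schottky_half_cball[of "f ^^ n" x "3/4"])
      show "(f ^^ n) holomorphic_on cball x (3/4)" by (rule holomorphic_funpow[OF holf])
      show "(f ^^ n) z \<noteq> c \<and> (f ^^ n) z \<noteq> d" if "z \<in> cball x (3/4)" for z
        using sub[OF that] c(2) d(2) by auto
      show "c \<noteq> d" using dc(1) \<open>\<delta> > 0\<close> by auto
      have "norm ((f ^^ n) x - c) \<le> B + norm a + 1"
        using norm_triangle_ineq4[of "(f ^^ n) x" c] B[of n] nc by linarith
      also have "\<dots> = \<rho> * \<delta>" using \<open>\<delta> > 0\<close> by (simp add: \<rho>_def)
      also have "\<dots> \<le> \<rho> * norm (d - c)" using dc(1) \<open>\<rho> \<ge> 0\<close> by (rule mult_left_mono)
      finally show "norm ((f ^^ n) x - c) \<le> \<rho> * norm (d - c)" .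
      show "y \<in> cball x (3 / 4 / 2)"
      proof -
        have "dist x y \<le> dist p x + dist p y" by (rule dist_triangle3)
        then show ?thesis using x(1) y by simp
      qed
    qed auto
    also have "\<dots> \<le> K * (dist a b + 2)"
      using dc(2) \<open>K > 0\<close> by (intro mult_left_mono) auto
    finally show ?thesis
      using norm_triangle_ineq2[of "(f ^^ n) y" c] nc by (simp add: C_def)
  qed
  then show ?thesis by blast
qed

text \<open>If no point outside \<open>cball 0 R\<close> were spreading, boundedness of orbits would propagate over
  this connected region from the single point given by \<open>transcendental_bounded_orbit_far\<close>,
  uniformly on compact sets and hence, by the maximum principle, to large discs. That contradicts
  the growth of the iterates.\<close>

lemma transcendental_spreading_far:
  assumes f: "transcendental_entire f"
  shows "\<exists>p. norm p > R \<and> spreading f p"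
proof (rule ccontr)
  assume "\<not> ?thesis"
  then have no: "\<not> spreading f p" if "norm p > R" for p using that by blast
  have holf: "f holomorphic_on UNIV" using f by (simp add: transcendental_entire_def)
  define V where "V = - cball (0::complex) R"
  have far: "norm p > R" if "p \<in> V" for p using that by (simp add: V_def)
  obtain z0 where z0: "z0 \<in> V" "bounded_orbit f z0"
    using transcendental_bounded_orbit_far[OF f, of R] by (auto simp: V_def not_le)
  have bdd: "bounded_orbit f z" if "z \<in> V" for z
  proof (rule connected_induction_simple[of V z0 z "bounded_orbit f"])
    show "connected V" unfolding V_def
      by (rule connected_complement_bounded_convex) auto
    fix p assume p: "p \<in> V"
    have spread: "bounded_orbit f x \<longrightarrow> bounded_orbit f y" if x: "x \<in> ball p (1/8)" and y: "y \<in> ball p (1/8)" for x y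
    proof
      assume "bounded_orbit f x"
      from non_spreading_orbits_bounded[OF holf no[OF far[OF p]] x this]
      show "bounded_orbit f y"
        using y unfolding bounded_orbit_iff by blast
    qed
    have op: "openin (top_of_set V) (V \<inter> ball p (1/8))"
      by (simp add: openin_open_Int)
    show "\<exists>T. openin (top_of_set V) T \<and> p \<in> T \<and>
        (\<forall>x\<in>T. \<forall>y\<in>T. bounded_orbit f x \<longrightarrow> bounded_orbit f y)"
    proof (intro exI conjI ballI)
      show "openin (top_of_set V) (V \<inter> ball p (1/8))" by (rule op)
      show "p \<in> V \<inter> ball p (1/8)" using p by simp
    qed (use spread in blast)
  qed (fact z0 that)+
  have "\<forall>p\<in>V. \<exists>C. \<forall>y\<in>ball p (1/8). \<forall>n. norm ((f ^^ n) y) \<le> C"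
  proof
    fix p assume p: "p \<in> V"
    have "p \<in> ball p (1/8)" by simp
    then show "\<exists>C. \<forall>y\<in>ball p (1/8). \<forall>n. norm ((f ^^ n) y) \<le> C"
      by (rule non_spreading_orbits_bounded[OF holf no[OF far[OF p]] _ bdd[OF p]])
  qed
  from bchoice[OF this] obtain C
    where C: "\<And>p y n. p \<in> V \<Longrightarrow> y \<in> ball p (1/8) \<Longrightarrow> norm ((f ^^ n) y) \<le> C p"
    by blast
  obtain r0 where r0: "r0 > 0"
    "\<And>r n. r \<ge> r0 \<Longrightarrow> \<exists>z\<in>cball 0 r. norm ((f ^^ n) z) \<ge> 2 ^ n * r"
    using transcendental_iterates_unbounded[OF f] by blast
  define r where "r = max r0 (R + 1)"
  have r: "r \<ge> r0" "r > R" "r > 0" using r0(1) by (auto simp: r_def)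
  have inV: "p \<in> V" if "p \<in> sphere 0 r" for p using that r by (simp add: V_def)
  have cov: "sphere 0 r \<subseteq> (\<Union>p\<in>sphere (0::complex) r. ball p (1/8))" by force
  obtain D where D: "D \<subseteq> sphere (0::complex) r" "finite D" "sphere 0 r \<subseteq> (\<Union>p\<in>D. ball p (1/8))"
    by (rule compactE_image[OF compact_sphere open_ball cov])
  define B where "B = Max (insert 0 (C ` D))"
  have B: "norm ((f ^^ n) y) \<le> B" if y: "y \<in> sphere 0 r" for y n
  proof -
    obtain p where p: "p \<in> D" "y \<in> ball p (1/8)" using D(3) y by blast
    then have "norm ((f ^^ n) y) \<le> C p" using C inV D(1) by blast
    also have "\<dots> \<le> B" unfolding B_def using D(2) p(1) by (intro Max_ge) auto
    finally show ?thesis .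
  qed
  obtain n where n: "B / r < 2 ^ n"
    using real_arch_pow[of 2 "B / r"] by auto
  obtain z where "z \<in> cball 0 r" "norm ((f ^^ n) z) \<ge> 2 ^ n * r"
    using r0(2)[OF r(1)] by blast
  then obtain w where "w \<in> sphere 0 r" "norm ((f ^^ n) w) \<ge> 2 ^ n * r"
    using maximum_modulus_cball[OF holomorphic_funpow[OF holf] r(3)] by metis
  then have "2 ^ n * r \<le> B" using B order_trans by blast
  then show False using n r(3) by (simp add: field_simps)
qed

section \<open>Oscillating orbits\<close>

text \<open>When iterates of \<open>f\<close> map each set of a sequence over the next one, some orbit visits all of
  them in this order: the points following the first \<open>k\<close> steps form a decreasing sequence of
  nonempty compact sets.\<close>

lemma orbit_through_compact_sets:
  fixes f :: "complex \<Rightarrow> complex"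
  assumes contf: "\<And>n. continuous_on UNIV (f ^^ n)"
    and comp: "\<And>k. compact (E k)" and nonempty: "\<And>k. E k \<noteq> {}"
    and cover: "\<And>k. E (Suc k) \<subseteq> (f ^^ n k) ` E k"
  obtains z where "\<And>k. (f ^^ (\<Sum>i<k. n i)) z \<in> E k"
proof -
  define N where "N k = (\<Sum>i<k. n i)" for k
  define X where "X k = {z. \<forall>j\<le>k. (f ^^ N j) z \<in> E j}" for k
  have reach: "\<exists>z\<in>X k. (f ^^ N k) z = y" if "y \<in> E k" for k y
    using that
  proof (induction k arbitrary: y)
    case 0
    then show ?case by (auto simp: X_def N_def)
  next
    case (Suc k)
    obtain x where x: "x \<in> E k" "y = (f ^^ n k) x" using cover Suc.prems by blast
    obtain z where z: "z \<in> X k" "(f ^^ N k) z = x" using Suc.IH[OF x(1)] by blast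
    have "N (Suc k) = n k + N k" by (simp add: N_def)
    then have "(f ^^ N (Suc k)) z = y" using x z by (simp add: funpow_add)
    then show ?case
      using z(1) Suc.prems by (intro bexI[of _ z]) (auto simp: X_def le_Suc_eq)
  qed
  have "\<Inter>(range X) \<noteq> {}"
  proof (rule compact_nest)
    fix k
    have eq: "X k = E 0 \<inter> (\<Inter>j\<in>{..k}. (f ^^ N j) -` E j)"
      by (auto simp: X_def N_def)
    have "closed ((f ^^ N j) -` E j)" for j
      using closed_vimage[of "E j" "f ^^ N j"] compact_imp_closed[OF comp] contf by blast
    then show "compact (X k)"
      unfolding eq using comp by (intro compact_Int_closed closed_INT) auto
    show "X k \<noteq> {}" using reach[of _ k] nonempty[of k] by blast
  qed (auto simp: X_def)
  then obtain z where "\<And>k. z \<in> X k" by blast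
  then show thesis using that[of z] by (auto simp: X_def N_def)
qed

text \<open>A spreading disc covers, under some iterate, one of any two separated discs. Choosing the
  two alternately from a fixed pair of spreading points and from spreading points further and
  further out gives an itinerary that returns to a bounded region and runs to infinity.\<close>

lemma transcendental_oscillating_orbit:
  assumes f: "transcendental_entire f"
  obtains z N R where "strict_mono N" "\<And>k. N k \<ge> 1"
    "\<And>k. even k \<Longrightarrow> norm ((f ^^ N k) z) < R" "\<And>k. odd k \<Longrightarrow> norm ((f ^^ N k) z) \<ge> real k"
proof -
  have holf: "f holomorphic_on UNIV" using f by (simp add: transcendental_entire_def)
  have step: "\<exists>q n. n \<ge> 1 \<and> q \<in> {a, b} \<and> cball q 1 \<subseteq> (f ^^ n) ` cball p 1"
    if "spreading f p" "norm b > norm a + 2" for p a b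
  proof -
    have "dist a b > 2"
      using that(2) norm_triangle_ineq2[of b a] by (simp add: dist_norm norm_minus_commute)
    then show ?thesis using that(1) unfolding spreading_def by blast
  qed
  obtain q1 where q1: "spreading f q1" using transcendental_spreading_far[OF f] by blast
  obtain q2 where q2: "spreading f q2" "norm q2 > norm q1 + 2"
    using transcendental_spreading_far[OF f] by blast
  define P where "P k p \<longleftrightarrow> spreading f p \<and> (if even k then norm p > real k + 1 else p \<in> {q1, q2})"
    for k :: nat and p
  have "\<exists>c. \<forall>k. P k (c k) \<and> (\<exists>n\<ge>1. cball (c (Suc k)) 1 \<subseteq> (f ^^ n) ` cball (c k) 1)"
  proof (rule dependent_nat_choice)
    show "\<exists>p. P 0 p" using transcendental_spreading_far[OF f, of 1] by (auto simp: P_def)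
    fix p k assume p: "P k p"
    then have sp: "spreading f p" by (simp add: P_def)
    obtain a b where ab: "norm b > norm a + 2" "P (Suc k) a" "P (Suc k) b"
    proof (cases "even k")
      case True
      then show ?thesis using that[of q1 q2] q1 q2 by (simp add: P_def)
    next
      case False
      obtain a where a: "spreading f a" "norm a > real k + 2"
        using transcendental_spreading_far[OF f] by blast
      obtain b where b: "spreading f b" "norm b > norm a + 2"
        using transcendental_spreading_far[OF f] by blast
      show ?thesis using that[of a b] a b False by (simp add: P_def)
    qed
    then show "\<exists>q. P (Suc k) q \<and> (\<exists>n\<ge>1. cball q 1 \<subseteq> (f ^^ n) ` cball p 1)"
      using step[OF sp ab(1)] by blast
  qed
  then obtain c n where c: "\<And>k. P k (c k)" and n: "\<And>k. n k \<ge> (1::nat)"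
    and cover: "\<And>k. cball (c (Suc k)) 1 \<subseteq> (f ^^ n k) ` cball (c k) 1"
    by metis
  obtain z where z: "\<And>k. (f ^^ (\<Sum>i<k. n i)) z \<in> cball (c k) 1"
  proof (rule orbit_through_compact_sets[of f "\<lambda>k. cball (c k) 1" n])
    show "continuous_on UNIV (f ^^ m)" for m
      by (rule holomorphic_on_imp_continuous_on[OF holomorphic_funpow[OF holf]])
  qed (use cover in auto)
  \<comment> \<open>The visit to \<open>c 0\<close> at time 0 is skipped, so that all times are positive; \<open>N k\<close> is the time
    of the visit to \<open>c (Suc k)\<close>, which exchanges even and odd.\<close>
  define N where "N k = (\<Sum>i<Suc k. n i)" for k
  show thesis
  proof
    show "strict_mono N"
      unfolding strict_mono_Suc_iff N_def using n by (simp add: Suc_le_eq)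
    show "N k \<ge> 1" for k
      using n[of k] by (simp add: N_def)
    fix k
    have "norm (c (Suc k) - (f ^^ N k) z) \<le> 1"
      using z[of "Suc k"] by (simp add: N_def dist_norm)
    then have d: "\<bar>norm (c (Suc k)) - norm ((f ^^ N k) z)\<bar> \<le> 1"
      using norm_triangle_ineq3 order_trans by blast
    { assume "even k"
      then have "norm (c (Suc k)) \<le> norm q2" using c[of "Suc k"] q2(2) by (auto simp: P_def)
      then show "norm ((f ^^ N k) z) < norm q2 + 2"
        using d by linarith }
    { assume "odd k"
      then have "norm (c (Suc k)) > real k + 2" using c[of "Suc k"] by (auto simp: P_def)
      then show "norm ((f ^^ N k) z) \<ge> real k"
        using d by linarith }
  qed
qed

text \<open>Unboundedness alone supplies an increasing sequence of indices along which the values tend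
  to infinity, because an initial segment of indices contributes only finitely many values.\<close>

lemma bungee_setI:
  assumes bdd: "infinite {i. norm (g i z) < R}" and unbdd: "\<not> bounded (range (\<lambda>i. g i z))"
  shows "z \<in> bungee_set g"
proof -
  obtain m :: "nat \<Rightarrow> nat" where m: "strict_mono m" "\<And>k. m k \<in> {i. norm (g i z) < R}"
    using infinite_enumerate[OF bdd] by blast
  have "R > 0" using m(2)[of 0] norm_ge_zero[of "g (m 0) z"] by (simp del: norm_ge_zero)
  have ex: "\<exists>j>i. norm (g j z) > B" for i B
  proof (rule ccontr)
    assume no: "\<not> ?thesis"
    have "norm (g j z) \<le> Max ((\<lambda>j. norm (g j z)) ` {..i}) + max B 0" for j
    proof (cases "j \<le> i")
      case True
      then have "norm (g j z) \<le> Max ((\<lambda>j. norm (g j z)) ` {..i})" by (intro Max_ge) auto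
      then show ?thesis by linarith
    next
      case False
      have "0 \<le> norm (g i z)" by simp
      also have "\<dots> \<le> Max ((\<lambda>j. norm (g j z)) ` {..i})" by (intro Max_ge) auto
      finally show ?thesis using False no by (meson add_increasing max.coboundedI1 not_le)
    qed
    then show False using unbdd by (auto simp: bounded_iff)
  qed
  have "\<exists>n. \<forall>k. norm (g (n k) z) > real k \<and> n (Suc k) > n k"
    by (rule dependent_nat_choice) (use ex in blast)+
  then obtain n :: "nat \<Rightarrow> nat" where n: "\<And>k. norm (g (n k) z) > real k" "\<And>k. n (Suc k) > n k"
    by blast
  have "filterlim (\<lambda>k. norm (g (n k) z)) at_top sequentially"
    by (rule filterlim_at_top_mono[OF filterlim_real_sequentially])
      (use n(1) in \<open>auto intro!: always_eventually less_imp_le\<close>)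
  moreover have "strict_mono n" using n(2) by (simp add: strict_mono_Suc_iff)
  ultimately show ?thesis
    unfolding bungee_set_def using m \<open>R > 0\<close> by blast
qed

lemma funpow_in_semigroup_generated:
  assumes "h \<in> F"
  shows "h ^^ Suc n \<in> semigroup_generated F"
proof (induction n)
  case 0
  then show ?case using assms by (simp add: generator)
next
  case (Suc n)
  then show ?case
    using composition[OF generator[OF assms] Suc] by (simp only: funpow.simps)
qed

theorem lemma4p3:
  fixes F :: "(complex \<Rightarrow> complex) set"
    and g :: "nat \<Rightarrow> complex \<Rightarrow> complex"
  assumes "countable F" and "F \<noteq> {}"
    and "\<And>h. h \<in> F \<Longrightarrow> transcendental_entire h"
    and "bij_betw g UNIV (semigroup_generated F)"
  shows "bungee_set g \<noteq> {}"
proof -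
  obtain f where "f \<in> F" using \<open>F \<noteq> {}\<close> by blast
  then have f: "transcendental_entire f" by (rule assms(3))
  obtain z N R where N: "strict_mono N" "\<And>k. N k \<ge> (1::nat)"
    and near: "\<And>k. even k \<Longrightarrow> norm ((f ^^ N k) z) < R"
    and far: "\<And>k. odd k \<Longrightarrow> norm ((f ^^ N k) z) \<ge> real k"
    using transcendental_oscillating_orbit[OF f] by metis
  have "\<exists>i. g i = f ^^ N k" for k
  proof -
    obtain l where "N k = Suc l" using N(2)[of k] by (cases "N k") auto
    then have "f ^^ N k \<in> range g"
      using funpow_in_semigroup_generated[OF \<open>f \<in> F\<close>, of l] assms(4) by (simp add: bij_betw_def)
    then show ?thesis by (metis imageE)
  qed
  then obtain i where i: "\<And>k. g (i k) = f ^^ N k" by metis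
  have unbounded: "\<exists>k. norm ((f ^^ N k) z) > B" for B
  proof -
    obtain m :: nat where "B < real m" using reals_Archimedean2 by blast
    moreover have "real (2 * m + 1) \<le> norm ((f ^^ N (2 * m + 1)) z)" by (rule far) simp
    ultimately show ?thesis by (intro exI[of _ "2 * m + 1"]) simp
  qed
  have "\<not> bounded_orbit f z"
    using unbounded by (auto simp: bounded_orbit_iff not_le)
  then have distinct: "f ^^ a \<noteq> f ^^ b" if "a < b" for a b
    using bounded_orbit_recurrence[of a f z b] that by metis
  have "inj (\<lambda>k. f ^^ N (2 * k))"
  proof (rule linorder_injI)
    fix k l :: nat assume "k < l"
    then show "f ^^ N (2 * k) \<noteq> f ^^ N (2 * l)"
      by (intro distinct strict_monoD[OF N(1)]) simp
  qed
  then have "inj (\<lambda>k. i (2 * k))"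
    by (metis (mono_tags, lifting) i injD injI)
  then have "infinite (range (\<lambda>k. i (2 * k)))"
    by (rule range_inj_infinite)
  moreover have "range (\<lambda>k. i (2 * k)) \<subseteq> {j. norm (g j z) < R}"
    using near by (auto simp: i)
  ultimately have "infinite {j. norm (g j z) < R}"
    using finite_subset by blast
  moreover have "\<not> bounded (range (\<lambda>j. g j z))"
  proof
    assume "bounded (range (\<lambda>j. g j z))"
    then obtain B where "\<And>j. norm (g j z) \<le> B" by (auto simp: bounded_iff)
    then show False using unbounded[of B] i by (metis not_le)
  qed
  ultimately show ?thesis using bungee_setI by blast
qed

end
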